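(* Let $S$ be a discrete valuation semiring, with valuation map $v:F(S)\to\mathbb{Z}_\infty$. Then the following statements are equivalent: (1) The unique maximal ideal of $S$ is subtractive; (2) The valuation map $v:F(S)\to\mathbb{Z}_\infty$ satisfies the $\min$-property; (3) $S$ is a subtractive semiring; (4) $S$ is a Gaussian semiring.
   Context: All semirings are commutative, with a zero $0$ (absorbing for multiplication) and an identity $1\neq 0$. A semifield is such a semiring in which every nonzero element is multiplicatively invertible. An ideal of $S$ is a nonempty subset $I$ closed under addition and under multiplication by elements of $S$; it is subtractive if $a+b\in I$ and $a\in I$ imply $b\in I$ for all $a,b\in S$. $S$ is a subtractive semiring if every ideal of $S$ is subtractive. For $f\in S[X]$, the content $c(f)$ is the ideal of $S$ generated by the coefficients of $f$. $S$ is Gaussian if $c(fg)=c(f)c(g)$ for all $f,g\in S[X]$ (the product of ideals $I,J$ is the set of finite sums of products $ab$ with $a\in I$, $b\in J$). Let $\mathbb{Z}_\infty=\mathbb{Z}\cup\{+\infty\}$ with the usual order and addition, with $+\infty$ greatest and absorbing for addition. A discrete valuation on a semiring $K$ is a map $v:K\to\mathbb{Z}_\infty$ such that $v(xy)=v(x)+v(y)$ and $v(x+y)\geq\min\{v(x),v(y)\}$ for all $x,y\in K$, $v(1)=0$ and $v(0)=+\infty$. $S$ is a discrete valuation semiring if there exist a semifield $K$ containing $S$ as a subsemiring and a surjective discrete valuation $v:K\to\mathbb{Z}_\infty$ with $S=\{s\in K: v(s)\geq 0\}$. In this case $S$ is multiplicatively cancellative with a unique maximal ideal, and $K$ is identified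 with the semifield of fractions $F(S)$ via the isomorphism $F(S)\to K$, $a/b\mapsto ab^{-1}$; thus $v$ is regarded as a map $F(S)\to\mathbb{Z}_\infty$, and this is the valuation map of $S$. A discrete valuation $v$ on $K$ satisfies the $\min$-property if for all $x,y\in K$, $v(x)\neq v(y)$ implies $v(x+y)=\min\{v(x),v(y)\}$. *)

theory Defs
  imports "HOL-Computational_Algebra.Polynomial"
begin

subsection \<open>The integers with a greatest element adjoined\<close>

datatype zinf = Fin int | Infty

instantiation zinf :: "{comm_monoid_add, linorder}"
begin

definition zero_zinf :: zinf where
  "0 = Fin 0"

fun plus_zinf :: "zinf \<Rightarrow> zinf \<Rightarrow> zinf" where
  "Fin a + Fin b = Fin (a + b)"
| "Infty + y = Infty"
| "x + Infty = Infty"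

fun less_eq_zinf :: "zinf \<Rightarrow> zinf \<Rightarrow> bool" where
  "Fin a \<le> Fin b \<longleftrightarrow> a \<le> b"
| "x \<le> Infty \<longleftrightarrow> True"
| "Infty \<le> Fin b \<longleftrightarrow> False"

definition less_zinf :: "zinf \<Rightarrow> zinf \<Rightarrow> bool" where
  "x < y \<longleftrightarrow> x \<le> y \<and> \<not> y \<le> (x :: zinf)"

instance
proof
  fix a b c :: zinf
  show "a + b + c = a + (b + c)"
    by (cases a; cases b; cases c) auto
  show "a + b = b + a"
    by (cases a; cases b) auto
  show "0 + a = a"
    by (cases a) (auto simp: zero_zinf_def)
  show "a < b \<longleftrightarrow> a \<le> b \<and> \<not> b \<le> a"
    by (rule less_zinf_def)
  show "a \<le> a"
    by (cases a) auto
  show "a \<le> b \<Longrightarrow> b \<le> c \<Longrightarrow> a \<le> c"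
    by (cases a; cases b; cases c) auto
  show "a \<le> b \<Longrightarrow> b \<le> a \<Longrightarrow> a = b"
    by (cases a; cases b) auto
  show "a \<le> b \<or> b \<le> a"
    by (cases a; cases b) auto
qed

end


subsection \<open>Ideals, subtractivity and contents\<close>

text \<open>
  Semirings are subsemirings \<open>S\<close> of an ambient type of class \<open>comm_semiring_1\<close>
  (which includes \<open>0 \<noteq> 1\<close> and \<open>0 * x = 0\<close>), and all notions are relative to \<open>S\<close>.
  For \<open>S = UNIV\<close> they are the absolute notions for the semiring given by the type.
\<close>

definition subsemiring :: "'a::comm_semiring_1 set \<Rightarrow> bool" where
  "subsemiring S \<longleftrightarrow> 0 \<in> S \<and> 1 \<in> S \<and> (\<forall>x\<in>S. \<forall>y\<in>S. x + y \<in> S \<and> x * y \<in> S)"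

definition ideal :: "'a::comm_semiring_1 set \<Rightarrow> 'a set \<Rightarrow> bool" where
  "ideal S I \<longleftrightarrow> I \<subseteq> S \<and> I \<noteq> {} \<and> (\<forall>a\<in>I. \<forall>b\<in>I. a + b \<in> I) \<and> (\<forall>s\<in>S. \<forall>a\<in>I. s * a \<in> I)"

definition subtractive_ideal :: "'a::comm_semiring_1 set \<Rightarrow> 'a set \<Rightarrow> bool" where
  "subtractive_ideal S I \<longleftrightarrow>
     ideal S I \<and> (\<forall>a\<in>S. \<forall>b\<in>S. a + b \<in> I \<longrightarrow> a \<in> I \<longrightarrow> b \<in> I)"

definition subtractive_semiring :: "'a::comm_semiring_1 set \<Rightarrow> bool" where
  "subtractive_semiring S \<longleftrightarrow> (\<forall>I. ideal S I \<longrightarrow> subtractive_ideal S I)"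

definition is_maximal_ideal :: "'a::comm_semiring_1 set \<Rightarrow> 'a set \<Rightarrow> bool" where
  "is_maximal_ideal S M \<longleftrightarrow>
     ideal S M \<and> M \<noteq> S \<and> (\<forall>J. ideal S J \<longrightarrow> M \<subseteq> J \<longrightarrow> J = M \<or> J = S)"

text \<open>Meaningful only if \<open>S\<close> has exactly one maximal ideal; see \<open>ex1_maximal_ideal\<close> below.\<close>

definition the_maximal_ideal :: "'a::comm_semiring_1 set \<Rightarrow> 'a set" where
  "the_maximal_ideal S = (THE M. is_maximal_ideal S M)"

definition ideal_prod :: "'a::comm_semiring_1 set \<Rightarrow> 'a set \<Rightarrow> 'a set" where
  "ideal_prod I J = {\<Sum>i<n. a i * b i | (n::nat) a b. \<forall>i<n. a i \<in> I \<and> b i \<in> J}"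

definition content_ideal :: "'a::comm_semiring_1 set \<Rightarrow> 'a poly \<Rightarrow> 'a set" where
  "content_ideal S f = ideal S hull range (coeff f)"

text \<open>The polynomial semiring over \<open>S\<close>, as a subset of the polynomials over the ambient semiring.\<close>

definition poly_over :: "'a::comm_semiring_1 set \<Rightarrow> 'a poly set" where
  "poly_over S = {f. \<forall>n. coeff f n \<in> S}"

definition gaussian_semiring :: "'a::comm_semiring_1 set \<Rightarrow> bool" where
  "gaussian_semiring S \<longleftrightarrow>
     (\<forall>f\<in>poly_over S. \<forall>g\<in>poly_over S.
        content_ideal S (f * g) = ideal_prod (content_ideal S f) (content_ideal S g))"


subsection \<open>Discrete valuation semirings\<close>

definition is_semifield :: "'k::comm_semiring_1 itself \<Rightarrow> bool" where
  "is_semifield _ \<longleftrightarrow> (\<forall>x::'k. x \<noteq> 0 \<longrightarrow> (\<exists>y. x * y = 1))"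

definition discrete_valuation :: "('k::comm_semiring_1 \<Rightarrow> zinf) \<Rightarrow> bool" where
  "discrete_valuation v \<longleftrightarrow>
     (\<forall>x y. v (x * y) = v x + v y) \<and> (\<forall>x y. v (x + y) \<ge> min (v x) (v y)) \<and>
     v 1 = 0 \<and> v 0 = Infty"

definition min_property :: "('k::comm_semiring_1 \<Rightarrow> zinf) \<Rightarrow> bool" where
  "min_property v \<longleftrightarrow> (\<forall>x y. v x \<noteq> v y \<longrightarrow> v (x + y) = min (v x) (v y))"

text \<open>
  The semifield \<open>K\<close> containing \<open>S\<close> is the whole type \<open>'k\<close>. It is identified with the
  semifield of fractions of \<open>S\<close>, which is justified by \<open>fractions\<close> and \<open>fraction_eq_iff\<close>
  below; so \<open>v\<close> is the valuation map of \<open>S\<close>.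
\<close>

definition discrete_valuation_semiring ::
    "'k::comm_semiring_1 set \<Rightarrow> ('k \<Rightarrow> zinf) \<Rightarrow> bool" where
  "discrete_valuation_semiring S v \<longleftrightarrow>
     is_semifield TYPE('k) \<and> subsemiring S \<and>
     discrete_valuation v \<and> surj v \<and> S = {s. v s \<ge> 0}"

context
  fixes S :: "'k::comm_semiring_1 set" and v :: "'k \<Rightarrow> zinf"
  assumes dvs: "discrete_valuation_semiring S v"
begin

lemma val_inverse:
  assumes "x * y = 1" obtains n where "v x = Fin n" "v y = Fin (- n)"
proof -
  have "v x + v y = Fin 0"
    using dvs assms
    by (metis discrete_valuation_semiring_def discrete_valuation_def zero_zinf_def)
  then show ?thesis
    by (cases "v x"; cases "v y") (auto intro: that)
qed

lemma fractions: "\<exists>a\<in>S. \<exists>b\<in>S - {0}. \<exists>c. b * c = 1 \<and> x = a * c"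
proof (cases "v x \<ge> 0")
  case True
  then show ?thesis
    using dvs by (auto simp: discrete_valuation_semiring_def subsemiring_def intro!: bexI[of _ x] bexI[of _ 1])
next
  case False
  then have "x \<noteq> 0"
    using dvs by (auto simp: discrete_valuation_semiring_def discrete_valuation_def zero_zinf_def)
  then obtain y where y: "x * y = 1"
    using dvs by (auto simp: discrete_valuation_semiring_def is_semifield_def)
  then obtain n where n: "v x = Fin n" "v y = Fin (- n)"
    by (rule val_inverse)
  have "v y \<ge> 0"
    using False n by (simp add: zero_zinf_def)
  then have "y \<in> S" "1 \<in> S" "y \<noteq> 0"
    using dvs y by (auto simp: discrete_valuation_semiring_def subsemiring_def)
  then show ?thesis
    using y by (metis Diff_iff mult.commute mult_1 singletonD)
qed

lemma fraction_eq_iff: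
  assumes "b * b' = 1" "d * d' = (1::'k)"
  shows "a * b' = c * d' \<longleftrightarrow> a * d = c * b"
proof
  assume "a * b' = c * d'"
  then have "(a * b') * (b * d) = (c * d') * (b * d)"
    by simp
  then have "(a * d) * (b * b') = (c * b) * (d * d')"
    by (simp add: ac_simps)
  with assms show "a * d = c * b"
    by simp
next
  assume "a * d = c * b"
  then have "(a * d) * (b' * d') = (c * b) * (b' * d')"
    by simp
  then have "(a * b') * (d * d') = (c * d') * (b * b')"
    by (simp add: ac_simps)
  with assms show "a * b' = c * d'"
    by simp
qed

lemma ex1_maximal_ideal: "\<exists>!M. is_maximal_ideal S M"
proof -
  let ?M = "{x. v x > 0}"
  note defs = discrete_valuation_semiring_def discrete_valuation_def
  have S: "S = {s. v s \<ge> 0}" and one: "v 1 = 0" and zero: "v 0 = Infty"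
    and mult: "\<And>x y. v (x * y) = v x + v y"
    and plus: "\<And>x y. v (x + y) \<ge> min (v x) (v y)"
    using dvs by (auto simp: defs)
  have "0 \<in> ?M"
    using zero by (simp add: zero_zinf_def less_zinf_def)
  moreover have "x + y \<in> ?M" if "x \<in> ?M" "y \<in> ?M" for x y
    using that plus[of x y] by (auto simp: min_def split: if_splits)
  moreover have "s * x \<in> ?M" if "s \<in> S" "x \<in> ?M" for s x
    using that S by (cases "v s"; cases "v x") (auto simp: mult zero_zinf_def less_zinf_def)
  ultimately have M: "ideal S ?M"
    using S unfolding ideal_def by auto
  have proper: "?M \<noteq> S"
  proof
    assume "?M = S"
    moreover have "1 \<in> S"
      using one S by simp
    ultimately have "1 \<in> ?M"
      by (rule ssubst)
    then show False
      using one by simp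
  qed
  have sub: "J \<subseteq> ?M" if J: "ideal S J" "J \<noteq> S" for J
  proof
    fix x assume x: "x \<in> J"
    show "x \<in> ?M"
    proof (rule ccontr)
      assume "x \<notin> ?M"
      then have vx: "v x = 0"
        using x J S by (auto simp: ideal_def)
      then have "x \<noteq> 0"
        using zero by (auto simp: zero_zinf_def)
      then obtain y where y: "x * y = 1"
        using dvs by (auto simp: defs is_semifield_def)
      then have "v y = 0"
        using vx by (auto elim!: val_inverse simp: zero_zinf_def)
      then have "y \<in> S"
        using S by simp
      then have "1 \<in> J"
        using J x y unfolding ideal_def by (metis mult.commute)
      then have "S \<subseteq> J"
        using J unfolding ideal_def by (metis mult.right_neutral subsetI)
      then show False
        using J by (auto simp: ideal_def)
    qed
  qed
  show ?thesis
  proof (rule ex1I[of _ ?M])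
    show "is_maximal_ideal S ?M"
      using M proper sub unfolding is_maximal_ideal_def by blast
    show "N = ?M" if "is_maximal_ideal S N" for N
      using that M proper sub unfolding is_maximal_ideal_def by blast
  qed
qed

end

end

theory Submission
  imports Defs
begin

text \<open>
  Since the ambient semiring is a semifield, \<open>v x \<le> v y\<close> means exactly that \<open>x\<close> divides \<open>y\<close> in
  \<open>S\<close> (\<open>val_le_imp_multiple\<close>). So every ideal of \<open>S\<close> is closed upwards with respect to \<open>v\<close>
  (\<open>ideal_val_upward_closed\<close>), and membership in an ideal is decided by valuations alone.

  The min-property makes every ideal subtractive: if \<open>a\<close> and \<open>a + b\<close> lie in an ideal, then either
  \<open>v a \<le> v b\<close> or \<open>v (a + b) = v b\<close>, and upward closure gives \<open>b\<close>. Conversely, if \<open>v x < v y\<close> but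
  \<open>v x < v (x + y)\<close>, division by \<open>x\<close> produces an element \<open>u\<close> such that \<open>u\<close> and \<open>1 + u\<close> lie in the
  maximal ideal while \<open>1\<close> does not. As the maximal ideal is one of the ideals of \<open>S\<close>, this settles
  the equivalence of the first three conditions.

  The min-property implies the Gaussian property by the classical argument of Gauss's lemma. The
  content of \<open>f\<close> is the principal ideal of all elements whose valuation is at least the smallest
  valuation of a coefficient. If \<open>i\<close> and \<open>j\<close> are the first indices at which \<open>f\<close> and \<open>g\<close> attain
  their smallest valuations, then in the coefficient of \<open>f * g\<close> at \<open>i + j\<close> the summand
  \<open>coeff f i * coeff g j\<close> has strictly smaller valuation than all others, so that it determines
  the valuation of the sum (\<open>min_property_coeff_mult\<close>).

  That the Gaussian property implies subtractivity is true for arbitrary semirings. It follows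
  from the identity
  \<open>(1 + X) (a + b X + a X^2) = a + (a + b) X + (a + b) X^2 + a X^3\<close>:
  the product of the contents on the left contains \<open>b\<close>, while the content on the right is the
  ideal generated by \<open>a\<close> and \<open>a + b\<close>.
\<close>


section \<open>Arithmetic of the integers with infinity\<close>

lemma zinf_add_mono: "a \<le> c \<Longrightarrow> b \<le> d \<Longrightarrow> a + b \<le> c + (d :: zinf)"
  by (cases a; cases b; cases c; cases d) auto

lemma zinf_add_strict_mono_left:
  "a < c \<Longrightarrow> b \<le> d \<Longrightarrow> b < Infty \<Longrightarrow> a + b < c + (d :: zinf)"
  by (cases a; cases b; cases c; cases d) (auto simp: less_zinf_def)

lemma zinf_le_Infty [simp]: "a \<le> Infty"
  by (cases a) auto

lemma zinf_less_Infty_iff: "a < Infty \<longleftrightarrow> a \<noteq> Infty"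
  by (cases a) (auto simp: less_zinf_def)


section \<open>Gaussian semirings are subtractive\<close>

lemma zero_in_ideal:
  assumes "subsemiring S" "ideal S I"
  shows "0 \<in> I"
proof -
  obtain a where "a \<in> I"
    using assms by (auto simp: ideal_def)
  then have "0 * a \<in> I"
    using assms unfolding ideal_def subsemiring_def by blast
  then show ?thesis
    by simp
qed

lemma coeff_in_content_ideal: "coeff f i \<in> content_ideal S f"
  unfolding content_ideal_def by (rule hull_inc) simp

theorem gaussian_imp_subtractive:
  assumes S: "subsemiring S" and gauss: "gaussian_semiring S"
  shows "subtractive_semiring S"
  unfolding subtractive_semiring_def subtractive_ideal_def
proof (intro allI impI conjI ballI)
  fix I a b
  assume I: "ideal S I" and ab: "a \<in> S" "b \<in> S" and sum: "a + b \<in> I" and a: "a \<in> I"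
  \<comment> \<open>The content of \<open>f * g\<close> is generated by \<open>a\<close> and \<open>a + b\<close>, although \<open>g\<close> has the coefficient \<open>b\<close>.\<close>
  define f where "f = [:1, 1 :: 'a:]"
  define g where "g = [:a, b, a:]"
  have "f \<in> poly_over S" "g \<in> poly_over S"
    using S ab by (auto simp: poly_over_def f_def g_def coeff_pCons subsemiring_def split: nat.splits)
  then have prod: "content_ideal S (f * g) = ideal_prod (content_ideal S f) (content_ideal S g)"
    using gauss by (simp add: gaussian_semiring_def)
  have "f * g = [:a, a + b, a + b, a:]"
    by (simp add: f_def g_def add.commute)
  then have "range (coeff (f * g)) \<subseteq> I"
    using a sum zero_in_ideal[OF S I] by (auto simp: coeff_pCons split: nat.splits)
  then have sub: "content_ideal S (f * g) \<subseteq> I"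
    unfolding content_ideal_def using I by (rule hull_minimal)
  have "1 \<in> content_ideal S f"
    using coeff_in_content_ideal[of f 0 S] by (simp add: f_def)
  moreover have "b \<in> content_ideal S g"
    using coeff_in_content_ideal[of g 1 S] by (simp add: g_def)
  ultimately have "b \<in> ideal_prod (content_ideal S f) (content_ideal S g)"
    unfolding ideal_prod_def mem_Collect_eq
    by (intro exI[of _ "1::nat"] exI[of _ "\<lambda>_. 1"] exI[of _ "\<lambda>_. b"]) simp
  with prod sub show "b \<in> I"
    by blast
qed


section \<open>Ideals of a discrete valuation semiring\<close>

context
  fixes S :: "'k::comm_semiring_1 set" and v :: "'k \<Rightarrow> zinf"
  assumes dvs: "discrete_valuation_semiring S v"
begin

lemma subsemiring_dvs: "subsemiring S"
  and mem_iff_val: "x \<in> S \<longleftrightarrow> 0 \<le> v x"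
  and val_mult: "v (x * y) = v x + v y"
  and val_add: "min (v x) (v y) \<le> v (x + y)"
  and val_one: "v 1 = 0"
  and val_zero: "v 0 = Infty"
  and ex_inverse: "x \<noteq> 0 \<Longrightarrow> \<exists>y. x * y = 1"
  using dvs by (auto simp: discrete_valuation_semiring_def discrete_valuation_def is_semifield_def)

lemma val_eq_Infty_iff: "v x = Infty \<longleftrightarrow> x = 0"
proof
  show "x = 0" if "v x = Infty"
    using that ex_inverse[of x] val_inverse[OF dvs, of x] by (metis zinf.distinct(1))
qed (simp add: val_zero)

text \<open>The quotient of the two elements in the semifield has nonnegative valuation.\<close>

lemma val_le_imp_multiple:
  assumes "v a \<le> v b"
  obtains s where "s \<in> S" "b = s * a"
proof (cases "a = 0")
  case True
  then have "b = 0"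
    using assms val_zero val_eq_Infty_iff by (metis antisym zinf_le_Infty)
  with True show ?thesis
    using that[of 1] subsemiring_dvs by (simp add: subsemiring_def)
next
  case False
  then obtain c where c: "a * c = 1"
    using ex_inverse by blast
  then obtain n where n: "v a = Fin n" "v c = Fin (- n)"
    by (rule val_inverse[OF dvs])
  have "0 \<le> v (b * c)"
    using assms n by (cases "v b") (auto simp: val_mult zero_zinf_def)
  moreover have "b = (b * c) * a"
    using c by (simp add: mult.assoc mult.commute[of c])
  ultimately show ?thesis
    using that mem_iff_val by blast
qed

lemma ideal_val_upward_closed:
  assumes "ideal S I" "a \<in> I" "v a \<le> v b"
  shows "b \<in> I"
  using assms by (metis val_le_imp_multiple ideal_def)

lemma ideal_val_ge:
  assumes "0 \<le> c"
  shows "ideal S {x. c \<le> v x}"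
  unfolding ideal_def
proof (intro conjI ballI)
  show "{x. c \<le> v x} \<subseteq> S"
    using assms by (auto simp: mem_iff_val intro: order.trans)
  have "0 \<in> {x. c \<le> v x}"
    by (simp add: val_zero)
  then show "{x. c \<le> v x} \<noteq> {}"
    by blast
  show "a + b \<in> {x. c \<le> v x}" if "a \<in> {x. c \<le> v x}" "b \<in> {x. c \<le> v x}" for a b
    using that order.trans[OF _ val_add[of a b]] by simp
  show "s * a \<in> {x. c \<le> v x}" if "s \<in> S" "a \<in> {x. c \<le> v x}" for s a
    using that zinf_add_mono[of 0 "v s" c "v a"] by (simp add: val_mult mem_iff_val)
qed

lemma is_maximal_the_maximal_ideal: "is_maximal_ideal S (the_maximal_ideal S)"
  unfolding the_maximal_ideal_def using ex1_maximal_ideal[OF dvs] by (rule theI')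

text \<open>
  A proper ideal does not contain \<open>1\<close>, so by upward closure it has only elements of positive
  valuation; these already form a proper ideal.
\<close>

lemma the_maximal_ideal_eq: "the_maximal_ideal S = {x. 0 < v x}"
proof -
  let ?M = "the_maximal_ideal S"
  have M: "ideal S ?M" "?M \<noteq> S"
    using is_maximal_the_maximal_ideal by (auto simp: is_maximal_ideal_def)
  have sub: "?M \<subseteq> {x. 0 < v x}"
  proof (rule ccontr)
    assume "\<not> ?M \<subseteq> {x. 0 < v x}"
    then obtain x where x: "x \<in> ?M" "\<not> 0 < v x"
      by blast
    have "y \<in> ?M" if "y \<in> S" for y
    proof (rule ideal_val_upward_closed[OF M(1) x(1)])
      show "v x \<le> v y"
        using x(2) that mem_iff_val by (metis not_less order.trans)
    qed
    then show False
      using M by (auto simp: ideal_def)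
  qed
  have "0 < v x \<longleftrightarrow> Fin 1 \<le> v x" for x
    by (cases "v x") (auto simp: zero_zinf_def less_zinf_def)
  then have pos: "ideal S {x. 0 < v x}"
    using ideal_val_ge[of "Fin 1"] by (simp add: zero_zinf_def)
  have "1 \<in> S" "1 \<notin> {x. 0 < v x}"
    by (simp_all add: mem_iff_val val_one)
  then have "{x. 0 < v x} \<noteq> S"
    by blast
  moreover have "{x. 0 < v x} = ?M \<or> {x. 0 < v x} = S"
    using is_maximal_the_maximal_ideal sub pos unfolding is_maximal_ideal_def by simp
  ultimately have "{x. 0 < v x} = ?M"
    by simp
  then show ?thesis
    by (rule sym)
qed


section \<open>Subtractivity and the min-property\<close>

lemma min_property_imp_subtractive:
  assumes "min_property v"
  shows "subtractive_semiring S"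
  unfolding subtractive_semiring_def subtractive_ideal_def
proof (intro allI impI conjI ballI)
  fix I a b
  assume I: "ideal S I" and sum: "a + b \<in> I" and a: "a \<in> I"
  show "b \<in> I"
  proof (cases "v a \<le> v b")
    case True
    then show ?thesis
      using I a by (blast intro: ideal_val_upward_closed)
  next
    case False
    then have "v (a + b) = v b"
      using assms by (auto simp: min_property_def)
    then show ?thesis
      using I sum by (auto intro: ideal_val_upward_closed)
  qed
qed

lemma subtractive_imp_maximal_subtractive:
  "subtractive_semiring S \<Longrightarrow> subtractive_ideal S (the_maximal_ideal S)"
  using is_maximal_the_maximal_ideal
  by (simp add: subtractive_semiring_def is_maximal_ideal_def)

text \<open>
  Division by the element of smaller valuation reduces the claim to a sum \<open>1 + u\<close> with \<open>u\<close> in the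
  maximal ideal, which subtractivity keeps outside the maximal ideal.
\<close>

lemma val_add_less:
  assumes sub: "subtractive_ideal S (the_maximal_ideal S)" and less: "v x < v y"
  shows "v (x + y) = v x"
proof (rule ccontr)
  assume "v (x + y) \<noteq> v x"
  then have less': "v x < v (x + y)"
    using val_add[of x y] less by (simp add: min_absorb1)
  have "x \<noteq> 0"
    using less val_zero leD zinf_le_Infty by metis
  then obtain z where z: "x * z = 1"
    using ex_inverse by blast
  then obtain n where n: "v x = Fin n" "v z = Fin (- n)"
    by (rule val_inverse[OF dvs])
  have pos: "0 < v (w * z)" if "v x < v w" for w
    using zinf_add_strict_mono_left[OF that order.refl[of "v z"]] n
    by (simp add: val_mult zero_zinf_def zinf_less_Infty_iff)
  have "y * z + 1 = (x + y) * z"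
    using z by (simp add: distrib_right add.commute)
  then have "y * z \<in> the_maximal_ideal S" "y * z + 1 \<in> the_maximal_ideal S"
    using pos[OF less] pos[OF less'] by (simp_all add: the_maximal_ideal_eq)
  moreover have "y * z \<in> S" "1 \<in> S"
    using pos[OF less] by (simp_all add: mem_iff_val val_one)
  ultimately have "1 \<in> the_maximal_ideal S"
    using sub unfolding subtractive_ideal_def by blast
  then show False
    by (simp add: the_maximal_ideal_eq val_one)
qed

lemma maximal_subtractive_imp_min_property:
  assumes "subtractive_ideal S (the_maximal_ideal S)"
  shows "min_property v"
  unfolding min_property_def
proof (intro allI impI)
  fix x y
  assume "v x \<noteq> v y"
  then consider "v x < v y" | "v y < v x"
    by (rule linorder_neqE)
  then show "v (x + y) = min (v x) (v y)"
  proof cases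
    case 1
    then show ?thesis
      using val_add_less[OF assms 1] by (simp add: min_absorb1)
  next
    case 2
    then show ?thesis
      using val_add_less[OF assms 2] by (simp add: min_absorb2 add.commute)
  qed
qed


section \<open>Gauss's lemma for contents\<close>

lemma content_ideal_eq_val_ge:
  assumes f: "f \<in> poly_over S" and min: "\<And>j. v (coeff f i) \<le> v (coeff f j)"
  shows "content_ideal S f = {x. v (coeff f i) \<le> v x}"
proof
  have "0 \<le> v (coeff f i)"
    using f by (simp add: poly_over_def mem_iff_val)
  then show "content_ideal S f \<subseteq> {x. v (coeff f i) \<le> v x}"
    unfolding content_ideal_def using min by (intro hull_minimal ideal_val_ge) auto
  show "{x. v (coeff f i) \<le> v x} \<subseteq> content_ideal S f"
    unfolding content_ideal_def hull_def by (auto intro: ideal_val_upward_closed)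
qed

lemma val_sum_ge:
  assumes "\<And>i. i \<in> A \<Longrightarrow> c \<le> v (h i)"
  shows "c \<le> v (sum h A)"
  using assms
proof (induction A rule: infinite_finite_induct)
  case (insert i A)
  then have "c \<le> min (v (h i)) (v (sum h A))"
    by simp
  also have "\<dots> \<le> v (h i + sum h A)"
    by (rule val_add)
  finally show ?case
    using insert by simp
qed (simp_all add: val_zero)

lemma val_sum_greater:
  assumes "\<And>i. i \<in> A \<Longrightarrow> c < v (h i)" "c < Infty"
  shows "c < v (sum h A)"
  using assms
proof (induction A rule: infinite_finite_induct)
  case (insert i A)
  then have "c < min (v (h i)) (v (sum h A))"
    by simp
  also have "\<dots> \<le> v (h i + sum h A)"
    by (rule val_add)
  finally show ?case
    using insert by simp
qed (simp_all add: val_zero)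

lemma ideal_prod_val_ge:
  assumes "a \<in> S"
  shows "ideal_prod {x. v a \<le> v x} {x. v b \<le> v x} = {x. v (a * b) \<le> v x}"
proof
  show "ideal_prod {x. v a \<le> v x} {x. v b \<le> v x} \<subseteq> {x. v (a * b) \<le> v x}"
    unfolding ideal_prod_def by (auto simp: val_mult intro!: val_sum_ge zinf_add_mono)
  show "{x. v (a * b) \<le> v x} \<subseteq> ideal_prod {x. v a \<le> v x} {x. v b \<le> v x}"
  proof
    fix x
    assume "x \<in> {x. v (a * b) \<le> v x}"
    then obtain s where s: "s \<in> S" "x = s * (a * b)"
      using val_le_imp_multiple by blast
    then have "v a \<le> v (s * a)"
      using zinf_add_mono[of 0 "v s" "v a" "v a"] by (simp add: val_mult mem_iff_val)
    with s show "x \<in> ideal_prod {x. v a \<le> v x} {x. v b \<le> v x}"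
      unfolding ideal_prod_def mem_Collect_eq
      by (intro exI[of _ "1::nat"] exI[of _ "\<lambda>_. s * a"] exI[of _ "\<lambda>_. b"])
        (simp add: mult.assoc)
  qed
qed

text \<open>
  Only finitely many values occur among the coefficients, so a smallest one exists even though
  all indices beyond the degree are allowed.
\<close>

lemma ex_first_min_coeff:
  obtains i where "\<And>j. v (coeff f i) \<le> v (coeff f j)" "\<And>j. j < i \<Longrightarrow> v (coeff f i) < v (coeff f j)"
proof -
  let ?V = "range (\<lambda>j. v (coeff f j))"
  have "range (coeff f) \<subseteq> coeff f ` {..degree f} \<union> {0}"
    by (auto simp: image_iff) (metis atMost_iff le_degree)
  then have "finite (range (coeff f))"
    by (rule finite_subset) simp
  then have fin: "finite ?V"
    using finite_imageI[of "range (coeff f)" v] by (simp add: image_image)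
  define P where "P i \<longleftrightarrow> v (coeff f i) = Min ?V" for i
  have "\<exists>i. P i"
    using Min_in[OF fin] by (auto simp: P_def)
  then have "P (Least P)"
    by (rule LeastI_ex)
  then have eq: "v (coeff f (Least P)) = Min ?V"
    by (simp add: P_def)
  have le: "v (coeff f (Least P)) \<le> v (coeff f j)" for j
    unfolding eq using fin by simp
  moreover have "v (coeff f (Least P)) < v (coeff f j)" if "j < Least P" for j
    using not_less_Least[OF that] le[of j] eq by (auto simp: P_def)
  ultimately show ?thesis
    by (rule that)
qed

text \<open>
  Every other summand of this coefficient has an index below \<open>i\<close> in \<open>f\<close> or below \<open>j\<close> in \<open>g\<close>.
  Its valuation is therefore strictly larger; strictness survives the addition of the other
  valuation because nonzero coefficients have finite valuation.
\<close>

lemma min_property_coeff_mult: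
  assumes min: "min_property v" and nz: "coeff f i \<noteq> 0" "coeff g j \<noteq> 0"
    and f: "\<And>k. v (coeff f i) \<le> v (coeff f k)" "\<And>k. k < i \<Longrightarrow> v (coeff f i) < v (coeff f k)"
    and g: "\<And>k. v (coeff g j) \<le> v (coeff g k)" "\<And>k. k < j \<Longrightarrow> v (coeff g j) < v (coeff g k)"
  shows "v (coeff (f * g) (i + j)) = v (coeff f i * coeff g j)"
proof -
  let ?h = "\<lambda>k. coeff f k * coeff g (i + j - k)"
  let ?c = "v (coeff f i * coeff g j)"
  let ?r = "sum ?h ({..i + j} - {i})"
  have fin: "v (coeff f i) < Infty" "v (coeff g j) < Infty" "?c < Infty"
    using nz by (cases "v (coeff f i)"; cases "v (coeff g j)";
        simp add: zinf_less_Infty_iff val_mult flip: val_eq_Infty_iff)+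
  have "?c < v (?h k)" if "k \<in> {..i + j} - {i}" for k
  proof (cases "k < i")
    case True
    then show ?thesis
      unfolding val_mult using f(2) g(1) fin by (intro zinf_add_strict_mono_left) auto
  next
    case False
    then have "i + j - k < j"
      using that by auto
    then have "v (coeff g j) + v (coeff f i) < v (coeff g (i + j - k)) + v (coeff f k)"
      using f(1) g(2) fin by (intro zinf_add_strict_mono_left) auto
    then show ?thesis
      by (simp add: val_mult add.commute)
  qed
  then have less: "?c < v ?r"
    using fin by (intro val_sum_greater)
  have "coeff (f * g) (i + j) = coeff f i * coeff g j + ?r"
    by (simp add: coeff_mult sum.remove[of "{..i + j}" i])
  then show ?thesis
    using min less by (simp add: min_property_def min_absorb1)
qed

lemma min_property_imp_gaussian:
  assumes min: "min_property v"
  shows "gaussian_semiring S"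
  unfolding gaussian_semiring_def
proof (intro ballI)
  fix f g
  assume fg: "f \<in> poly_over S" "g \<in> poly_over S"
  obtain i where i: "\<And>k. v (coeff f i) \<le> v (coeff f k)"
      "\<And>k. k < i \<Longrightarrow> v (coeff f i) < v (coeff f k)"
    using ex_first_min_coeff[of f] by metis
  obtain j where j: "\<And>k. v (coeff g j) \<le> v (coeff g k)"
      "\<And>k. k < j \<Longrightarrow> v (coeff g j) < v (coeff g k)"
    using ex_first_min_coeff[of g] by metis
  have ge: "v (coeff f i * coeff g j) \<le> v (coeff (f * g) k)" for k
    unfolding coeff_mult val_mult
    by (rule val_sum_ge) (auto simp: val_mult intro!: zinf_add_mono i(1) j(1))
  have eq: "v (coeff (f * g) (i + j)) = v (coeff f i * coeff g j)"
    \<comment> \<open>A minimal coefficient vanishes only if the whole polynomial does.\<close>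
  proof (cases "coeff f i = 0 \<or> coeff g j = 0")
    case True
    then have "v (coeff f i * coeff g j) = Infty"
      by (auto simp: val_zero)
    then show ?thesis
      using ge[of "i + j"] by (metis antisym zinf_le_Infty)
  next
    case False
    then show ?thesis
      using min i j by (intro min_property_coeff_mult) auto
  qed
  have "coeff f k \<in> S" "coeff g k \<in> S" for k
    using fg by (auto simp: poly_over_def)
  then have "f * g \<in> poly_over S"
    using ge zinf_add_mono[of 0 "v (coeff f i)" 0 "v (coeff g j)"]
    by (fastforce simp: poly_over_def mem_iff_val val_mult intro: order.trans)
  then have "content_ideal S (f * g) = {x. v (coeff f i * coeff g j) \<le> v x}"
    using ge content_ideal_eq_val_ge[of "f * g" "i + j"] by (simp add: eq)
  also have "\<dots> = ideal_prod {x. v (coeff f i) \<le> v x} {x. v (coeff g j) \<le> v x}"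
    using fg by (intro ideal_prod_val_ge[symmetric]) (simp add: poly_over_def)
  also have "\<dots> = ideal_prod (content_ideal S f) (content_ideal S g)"
    by (simp only: content_ideal_eq_val_ge[OF fg(1) i(1)] content_ideal_eq_val_ge[OF fg(2) j(1)])
  finally show "content_ideal S (f * g) = ideal_prod (content_ideal S f) (content_ideal S g)" .
qed

end


section \<open>The equivalence\<close>

theorem theorem4p8:
  fixes S :: "'k::comm_semiring_1 set" and v :: "'k \<Rightarrow> zinf"
  assumes "discrete_valuation_semiring S v"
  shows "(subtractive_ideal S (the_maximal_ideal S) \<longleftrightarrow> min_property v) \<and>
         (min_property v \<longleftrightarrow> subtractive_semiring S) \<and>
         (subtractive_semiring S \<longleftrightarrow> gaussian_semiring S)"
  using maximal_subtractive_imp_min_property[OF assms] min_property_imp_subtractive[OF assms]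
    subtractive_imp_maximal_subtractive[OF assms] min_property_imp_gaussian[OF assms]
    gaussian_imp_subtractive[OF subsemiring_dvs[OF assms]]
  by blast

end
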